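(* Let $A$ be a nonnegative integer-valued random variable and $\{B_i\}_{i\ge1}$ i.i.d. nonnegative integer-valued random variables with the law of $B$, with $A$ and $\{B_i\}_{i\ge1}$ independent. Assume $\mathbb P(A>x)\sim(1+x)^{-1}$ as $x\to\infty$; $\mathbb P(B>x)=L(x)/(1+x)$ with $L$ slowly varying and $L(x)\sim(\log x)^{-1-\varepsilon}$ for some $\varepsilon>0$; and $b:=\mathbb E B\in(0,1)$. Let $X$ satisfy $X\stackrel{d}{=}A+\sum_{i=1}^{X}B_i$. Define the laws of $D_n$, $n\ge1$, by $D_1\stackrel{d}{=}B$ and $D_{n+1}\stackrel{d}{=}\sum_{j=1}^{B}D_{n,j}$, where $\{D_{n,j}\}_{j\ge1}$ are i.i.d. copies of $D_n$ independent of $B$. Then there exist i.i.d. copies $\{A_n\}_{n\ge1}$ of $A$ and, for each $n\ge1$, i.i.d. copies $\{D_{n,i}\}_{i\ge1}$ of $D_n$, such that $$X\ \stackrel{d}{=}\ A+\sum_{n\ge1}\ \sum_{i=1}^{A_{n+1}}D_{n,i},$$ with all the families $A$, $\{A_{n+1}\}_{n\ge1}$, $\{D_{n,i}\}_{i\ge1}$ ($n\ge1$) appearing on the right-hand side mutually independent.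
   Context: $\stackrel{d}{=}$ denotes equality in distribution; $f(x)\sim g(x)$ means $f(x)/g(x)\to1$ as $x\to\infty$. A measurable $L:(0,\infty)\to(0,\infty)$ is slowly varying if $L(tx)/L(x)\to1$ as $x\to\infty$ for each $t>0$. Fixed point: $X$ is a (finite) nonnegative integer-valued random variable such that, when $X$, $A$ and $\{B_i\}_{i\ge1}$ are taken independent on the right-hand side, $A+\sum_{i=1}^X B_i$ has the same distribution as $X$. Empty sums are $0$. *)

theory Defs
  imports "HOL-Probability.Probability" "HOL-Library.Landau_Symbols"
begin

definition slowly_varying :: "(real \<Rightarrow> real) \<Rightarrow> bool" where
  "slowly_varying L \<longleftrightarrow>
     L \<in> borel_measurable (restrict_space borel {0<..}) \<and>
     (\<forall>x>0. L x > 0) \<and>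
     (\<forall>t>0. ((\<lambda>x. L (t * x) / L x) \<longlongrightarrow> 1) at_top)"

abbreviation law :: "'a measure \<Rightarrow> ('a \<Rightarrow> nat) \<Rightarrow> nat measure" where
  "law M Y \<equiv> distr M (count_space UNIV) Y"

text \<open>The law of $\sum_{j=1}^{N} S_j$, where $N$ has law \<open>\<nu>\<close>, the $S_j$ ($j \ge 1$) are
  i.i.d. with law \<open>\<mu>\<close>, and $N$ is independent of $(S_j)_{j \ge 1}$.\<close>

definition random_sum_law :: "nat measure \<Rightarrow> nat measure \<Rightarrow> nat measure" where
  "random_sum_law \<nu> \<mu> =
     law (\<nu> \<Otimes>\<^sub>M (\<Pi>\<^sub>M j\<in>{1::nat..}. \<mu>)) (\<lambda>(k, s). \<Sum>j=1..k. s j)"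

text \<open>Index types that collect differently indexed random variables into one family, so that
  their joint independence can be expressed by \<open>indep_vars\<close>.\<close>

datatype input_index = InX | InA | InB nat

datatype output_index = OutA | OutAs nat | OutD nat nat

end

theory Submission
  imports Defs
begin

text \<open>The generating functions \<open>G\<^sub>X\<close>, \<open>G\<^sub>A\<close>, \<open>\<phi> = G\<^sub>B\<close> satisfy \<open>G\<^sub>X(z) = G\<^sub>A(z) G\<^sub>X(\<phi>(z))\<close>, and
  \<open>D\<^sub>n\<close> has generating function \<open>\<phi>\<^sup>n\<close>, the \<open>n\<close>-fold iterate. Since \<open>1 - \<phi>\<^sup>n(z) \<le> b\<^sup>n (1 - z)\<close>,
  iterating gives \<open>G\<^sub>X(z) = lim \<Prod>\<^sub>m\<^sub><\<^sub>n G\<^sub>A(\<phi>\<^sup>m(z))\<close>. The product is the generating function of the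
  \<open>n\<close>-th partial sum on the right-hand side, so these sums converge almost surely and the limit has
  the law of \<open>X\<close>.\<close>

subsection \<open>Generating functions of laws on the natural numbers\<close>

text \<open>All subsets are measurable, so every function on the space is measurable and the measure
  is determined by its point masses.\<close>

locale nat_prob_space = prob_space \<mu> for \<mu> :: "nat measure" +
  assumes sets_eq_count_space [measurable_cong]: "sets \<mu> = sets (count_space UNIV)"
begin

lemma space_eq_UNIV [simp]: "space \<mu> = UNIV"
  using sets_eq_imp_space_eq[OF sets_eq_count_space] by simp

lemma prob_UNIV [simp]: "prob UNIV = 1"
  using prob_space by simp

lemma measurable_nat_law [simp]: "f \<in> measurable \<mu> K \<longleftrightarrow> f \<in> UNIV \<rightarrow> space K"
  by (simp add: measurable_cong_sets[OF sets_eq_count_space refl])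

lemma integrable_power [simp]:
  fixes z :: real
  assumes "0 \<le> z" "z \<le> 1"
  shows "integrable \<mu> (\<lambda>k. z ^ k)"
  by (rule integrable_const_bound[where B = 1]) (use assms in \<open>auto simp: power_le_one\<close>)

end

lemma (in prob_space) nat_prob_space_law:
  assumes "Y \<in> measurable M (count_space UNIV)"
  shows "nat_prob_space (law M Y)"
  using prob_space_distr[OF assms] by (simp add: nat_prob_space_def nat_prob_space_axioms_def)

text \<open>The integral form passes through \<open>distr\<close> and Fubini without rearranging
  series; for \<open>z\<close> in [0,1] the integrand is bounded by 1.\<close>

definition pgf :: "nat measure \<Rightarrow> real \<Rightarrow> real" where
  "pgf \<mu> z = (\<integral>k. z ^ k \<partial>\<mu>)"

lemma pgf_law:
  assumes "Y \<in> measurable M (count_space UNIV)"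
  shows "pgf (law M Y) z = (\<integral>\<omega>. z ^ Y \<omega> \<partial>M)"
  unfolding pgf_def by (rule integral_distr) (use assms in auto)

context nat_prob_space
begin

lemma pgf_nonneg: "0 \<le> z \<Longrightarrow> 0 \<le> pgf \<mu> z"
  unfolding pgf_def by (intro integral_nonneg_AE) auto

lemma pgf_le_1:
  assumes "0 \<le> z" "z \<le> 1"
  shows "pgf \<mu> z \<le> 1"
proof -
  have "pgf \<mu> z \<le> (\<integral>k. 1 \<partial>\<mu>)"
    unfolding pgf_def using assms by (intro integral_mono) (auto simp: power_le_one)
  thus ?thesis by simp
qed

lemma pgf_1 [simp]: "pgf \<mu> 1 = 1"
  by (simp add: pgf_def)

text \<open>Dominated convergence with bound 1. It serves at the endpoint 1, both for iterates of a
  generating function and for sequences rising to 1.\<close>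

lemma tendsto_pgf:
  assumes "\<And>n. 0 \<le> x n" "\<And>n. x n \<le> 1" "x \<longlonglongrightarrow> z"
  shows "(\<lambda>n. pgf \<mu> (x n)) \<longlonglongrightarrow> pgf \<mu> z"
  unfolding pgf_def
  by (rule integral_dominated_convergence[where w = "\<lambda>_. 1"])
     (use assms in \<open>auto intro!: tendsto_power simp: power_le_one\<close>)

text \<open>Bernoulli's inequality \<open>1 - z ^ k \<le> k * (1 - z)\<close>, integrated. For a
  mean below 1 it makes the generating function contract towards its fixed point 1.\<close>

lemma one_minus_pgf_le:
  assumes "integrable \<mu> real" "0 \<le> z" "z \<le> 1"
  shows "1 - pgf \<mu> z \<le> (\<integral>k. real k \<partial>\<mu>) * (1 - z)"
proof -
  have *: "1 - z ^ k \<le> real k * (1 - z)" for k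
    using Bernoulli_inequality[of "z - 1" k] assms by (simp add: algebra_simps)
  have "1 - pgf \<mu> z = (\<integral>k. 1 - z ^ k \<partial>\<mu>)"
    using assms by (simp add: pgf_def)
  also have "\<dots> \<le> (\<integral>k. real k * (1 - z) \<partial>\<mu>)"
    using assms * by (intro integral_mono) auto
  finally show ?thesis by simp
qed

text \<open>The terms beyond \<open>n\<close> are pointwise at most \<open>z ^ Suc n\<close>, and
  the total mass is 1. This remainder bound lets the coefficients be read off as \<open>z\<close>
  tends to 0.\<close>

lemma pgf_expand:
  assumes "0 < z" "z < 1"
  shows "\<bar>pgf \<mu> z - (\<Sum>j\<le>n. prob {j} * z ^ j)\<bar> \<le> z ^ Suc n"
proof -
  have int: "integrable \<mu> (\<lambda>k. indicator {j} k * z ^ j)" for j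
    by (rule integrable_const_bound[where B = 1])
       (use assms in \<open>auto simp: power_le_one indicator_def\<close>)
  have "(\<Sum>j\<le>n. prob {j} * z ^ j) = (\<integral>k. (\<Sum>j\<le>n. indicator {j} k * z ^ j) \<partial>\<mu>)"
    by (subst Bochner_Integration.integral_sum) (use int in \<open>auto simp: sets_eq_count_space\<close>)
  hence eq: "pgf \<mu> z - (\<Sum>j\<le>n. prob {j} * z ^ j)
      = (\<integral>k. z ^ k - (\<Sum>j\<le>n. indicator {j} k * z ^ j) \<partial>\<mu>)"
    unfolding pgf_def using assms
    by (subst Bochner_Integration.integral_diff) (simp_all only: integrable_power less_imp_le
        Bochner_Integration.integrable_sum[OF int])
  \<comment> \<open>At each \<open>k\<close> at most one indicator is nonzero, so the sum is
    \<open>z ^ k\<close> cut off after \<open>n\<close>.\<close>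
  have *: "(\<Sum>j\<le>n. indicator {j} k * z ^ j) = (if k \<le> n then z ^ k else 0)" for k
    by (simp add: indicator_def of_bool_def if_distrib[where f = "\<lambda>x. x * _"] cong: if_cong)
  have bnd: "norm (z ^ k - (\<Sum>j\<le>n. indicator {j} k * z ^ j)) \<le> z ^ Suc n" for k
    unfolding * using assms power_decreasing[of "Suc n" k z] by (auto simp: not_le)
  have "norm (\<integral>k. z ^ k - (\<Sum>j\<le>n. indicator {j} k * z ^ j) \<partial>\<mu>)
      \<le> (\<integral>k. norm (z ^ k - (\<Sum>j\<le>n. indicator {j} k * z ^ j)) \<partial>\<mu>)"
    by (rule integral_norm_bound)
  also have "\<dots> \<le> (\<integral>k. z ^ Suc n \<partial>\<mu>)"
    by (rule integral_mono') (use bnd assms in auto)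
  finally show ?thesis unfolding eq by simp
qed

end

text \<open>Strong induction on the point masses: those below \<open>n\<close> cancel, which leaves
  \<open>d * z ^ n \<le> 2 * z ^ Suc n\<close> for the difference \<open>d\<close> at
  \<open>n\<close>. Dividing by \<open>z ^ n\<close> and letting \<open>z\<close> tend to 0 gives
  \<open>d = 0\<close>.\<close>

lemma nat_measure_eqI_pgf:
  assumes "nat_prob_space \<mu>" "nat_prob_space \<nu>"
    and eq: "\<And>z. 0 < z \<Longrightarrow> z < 1 \<Longrightarrow> pgf \<mu> z = pgf \<nu> z"
  shows "\<mu> = \<nu>"
proof -
  interpret M: nat_prob_space \<mu> by fact
  interpret N: nat_prob_space \<nu> by fact
  have m: "measure \<mu> {n} = measure \<nu> {n}" for n
  proof (induction n rule: less_induct)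
    case (less n)
    define d where "d = \<bar>measure \<mu> {n} - measure \<nu> {n}\<bar>"
    have bnd: "d \<le> 2 * z" if z: "0 < z" "z < 1" for z
    proof -
      have split: "(\<Sum>j\<le>n. c j * z ^ j) = (\<Sum>j<n. c j * z ^ j) + c n * z ^ n" for c :: "nat \<Rightarrow> real"
        by (simp add: lessThan_Suc_atMost[symmetric])
      have "(\<Sum>j<n. measure \<mu> {j} * z ^ j) = (\<Sum>j<n. measure \<nu> {j} * z ^ j)"
        using less.IH by simp
      hence "\<bar>measure \<mu> {n} * z ^ n - measure \<nu> {n} * z ^ n\<bar> \<le> 2 * z ^ Suc n"
        using M.pgf_expand[OF z, of n] N.pgf_expand[OF z, of n] eq[OF z] unfolding split by linarith
      moreover have "\<bar>measure \<mu> {n} * z ^ n - measure \<nu> {n} * z ^ n\<bar> = d * z ^ n"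
        unfolding d_def using z by (simp add: abs_mult flip: left_diff_distrib)
      ultimately have "d * z ^ n \<le> (2 * z) * z ^ n" by simp
      thus ?thesis using z by simp
    qed
    have "d \<le> 0"
    proof (rule ccontr)
      assume "\<not> d \<le> 0"
      \<comment> \<open>At \<open>z = d / 4\<close> the bound reads \<open>d \<le> d / 2\<close>.
        The cap 1/2 keeps \<open>z\<close> below 1; when it takes effect, \<open>d > 2\<close>
        contradicts \<open>d \<le> 1\<close>.\<close>
      hence "0 < min (d / 4) (1 / 2)" "min (d / 4) (1 / 2) < 1" by auto
      from bnd[OF this] show False using \<open>\<not> d \<le> 0\<close> by (auto simp: min_def split: if_splits)
    qed
    thus ?case by (simp add: d_def)
  qed
  show ?thesis
    by (rule measure_eqI_countable[where A = UNIV])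
       (simp_all add: M.sets_eq_count_space N.sets_eq_count_space M.emeasure_eq_measure
          N.emeasure_eq_measure m)
qed

subsection \<open>Coordinates of product measures and sums with a random number of terms\<close>

text \<open>The joint law of the selected coordinates and the product of their marginals are both
  \<open>PiM I (\<lambda>i. M (f i))\<close>. The injection \<open>f\<close> allows families that
  use only some coordinates, under other names.\<close>

lemma indep_vars_PiM_coordinates:
  assumes M: "\<And>i. i \<in> K \<Longrightarrow> prob_space (M i)"
    and f: "inj_on f I" "f \<in> I \<rightarrow> K" and I: "I \<noteq> {}"
  shows "prob_space.indep_vars (PiM K M) (\<lambda>i. M (f i)) (\<lambda>i \<omega>. \<omega> (f i)) I"
proof -
  interpret prob_space "PiM K M" by (rule prob_space_PiM) (rule M)
  have "(\<Pi>\<^sub>M i\<in>I. distr (PiM K M) (M (f i)) (\<lambda>\<omega>. \<omega> (f i))) = (\<Pi>\<^sub>M i\<in>I. M (f i))"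
    using f by (intro PiM_cong refl distr_PiM_component M) auto
  moreover have "distr (PiM K M) (\<Pi>\<^sub>M i\<in>I. M (f i)) (\<lambda>\<omega>. \<lambda>i\<in>I. \<omega> (f i)) = (\<Pi>\<^sub>M i\<in>I. M (f i))"
    by (rule distr_PiM_reindex) (use M f in auto)
  ultimately show ?thesis
    using f by (subst indep_vars_iff_distr_eq_PiM'[OF I])
      (auto intro!: measurable_component_singleton)
qed

text \<open>The number of terms takes countably many values, so each fixed number can be treated
  separately. \<open>P\<close> is arbitrary because the sum occurs both on a sample space and as a
  function of the coordinates of a product.\<close>

lemma measurable_random_sum:
  fixes Y :: "'i \<Rightarrow> 'a \<Rightarrow> nat"
  assumes "Y x \<in> measurable P (count_space UNIV)"
    and "\<And>i. i \<ge> 1 \<Longrightarrow> Y (W i) \<in> measurable P (count_space UNIV)"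
  shows "(\<lambda>\<omega>. \<Sum>i=1..Y x \<omega>. Y (W i) \<omega>) \<in> measurable P (count_space UNIV)"
proof (rule measurable_compose_countable[where g = "Y x"])
  show "(\<lambda>\<omega>. \<Sum>i=1..k. Y (W i) \<omega>) \<in> measurable P (count_space UNIV)" for k
    by (rule measurable_sum_nat) (use assms in auto)
qed (use assms in auto)

lemma random_sum_law_measurable:
  assumes "nat_prob_space \<nu>" "nat_prob_space \<mu>"
  shows "(\<lambda>(k, s). \<Sum>j=1..k. s j)
    \<in> measurable (\<nu> \<Otimes>\<^sub>M (\<Pi>\<^sub>M j\<in>{1::nat..}. \<mu>)) (count_space (UNIV :: nat set))"
proof -
  interpret M: nat_prob_space \<nu> by fact
  interpret N: nat_prob_space \<mu> by fact
  have sets: "sets (\<nu> \<Otimes>\<^sub>M (\<Pi>\<^sub>M j\<in>{1::nat..}. \<mu>))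
      = sets (count_space UNIV \<Otimes>\<^sub>M (\<Pi>\<^sub>M j\<in>{1::nat..}. count_space UNIV))"
    by (intro sets_pair_measure_cong sets_PiM_cong M.sets_eq_count_space N.sets_eq_count_space refl)
  have comp: "(\<lambda>q. snd q j) \<in> measurable (count_space (UNIV :: nat set) \<Otimes>\<^sub>M (\<Pi>\<^sub>M j\<in>{1::nat..}. count_space (UNIV :: nat set))) (count_space UNIV)"
    if "j \<ge> 1" for j
    by (rule measurable_compose[OF measurable_snd measurable_component_singleton]) (use that in auto)
  show ?thesis
    unfolding measurable_cong_sets[OF sets refl] case_prod_beta
  proof (rule measurable_compose_countable[where g = fst and f = "\<lambda>k q. sum (snd q) {1..k}"])
    show "(\<lambda>q. sum (snd q) {1..k}) \<in> measurable (count_space (UNIV :: nat set) \<Otimes>\<^sub>M (\<Pi>\<^sub>M j\<in>{1::nat..}. count_space (UNIV :: nat set))) (count_space UNIV)" for k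
      by (rule measurable_sum_nat) (use comp in auto)
  qed (rule measurable_fst)
qed

lemma nat_prob_space_random_sum_law:
  assumes "nat_prob_space \<nu>" "nat_prob_space \<mu>"
  shows "nat_prob_space (random_sum_law \<nu> \<mu>)"
proof -
  interpret M: nat_prob_space \<nu> by fact
  interpret N: nat_prob_space \<mu> by fact
  interpret S: prob_space "\<Pi>\<^sub>M j\<in>{1::nat..}. \<mu>" by (rule prob_space_PiM) unfold_locales
  interpret MP: pair_prob_space \<nu> "\<Pi>\<^sub>M j\<in>{1::nat..}. \<mu>" ..
  show ?thesis
    unfolding random_sum_law_def by (rule MP.P.nat_prob_space_law) (rule random_sum_law_measurable[OF assms])
qed

text \<open>Given \<open>k\<close> terms, independence yields \<open>pgf \<mu> z ^ k\<close>; Fubini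
  integrates this over \<nu>. Random sums thus become compositions of generating functions.\<close>

lemma pgf_random_sum_law:
  assumes "nat_prob_space \<nu>" "nat_prob_space \<mu>" and z: "0 \<le> z" "z \<le> 1"
  shows "pgf (random_sum_law \<nu> \<mu>) z = pgf \<nu> (pgf \<mu> z)"
proof -
  interpret M: nat_prob_space \<nu> by fact
  interpret N: nat_prob_space \<mu> by fact
  interpret S: prob_space "\<Pi>\<^sub>M j\<in>{1::nat..}. \<mu>" by (rule prob_space_PiM) unfold_locales
  interpret MP: pair_prob_space \<nu> "\<Pi>\<^sub>M j\<in>{1::nat..}. \<mu>" ..
  note meas = random_sum_law_measurable[OF assms(1,2)]
  \<comment> \<open>The empty family is treated apart, since the coordinate lemma asks for a
    nonempty index set.\<close>
  have ind: "S.indep_vars (\<lambda>_. borel) (\<lambda>j s. z ^ s j) {1..k}" for k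
  proof (cases "k = 0")
    case False
    have "S.indep_vars (\<lambda>_. \<mu>) (\<lambda>j s. s j) {1..k}"
      by (rule indep_vars_PiM_coordinates) (use False in \<open>auto intro: N.prob_space_axioms\<close>)
    thus ?thesis by (rule  S.indep_vars_compose2) auto
  qed (unfold S.indep_vars_def S.indep_sets_def, simp)
  have comp: "(\<lambda>s. s j) \<in> measurable (\<Pi>\<^sub>M j\<in>{1::nat..}. \<mu>) \<mu>" if "j \<ge> 1" for j
    by (rule measurable_component_singleton) (use that in auto)
  have int1: "integrable (\<Pi>\<^sub>M j\<in>{1::nat..}. \<mu>) (\<lambda>s. z ^ s j)" if "j \<ge> 1" for j
    by (rule S.integrable_const_bound[where B = 1])
      (use z measurable_compose[OF comp[OF that], of "\<lambda>k. z ^ k" borel] in \<open>auto simp: power_le_one\<close>)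
  have marg: "(\<integral>s. z ^ s j \<partial>(\<Pi>\<^sub>M j\<in>{1::nat..}. \<mu>)) = pgf \<mu> z" if "j \<ge> 1" for j
  proof -
    have "(\<integral>s. z ^ s j \<partial>(\<Pi>\<^sub>M j\<in>{1::nat..}. \<mu>))
        = (\<integral>k. z ^ k \<partial>(distr (\<Pi>\<^sub>M j\<in>{1::nat..}. \<mu>) \<mu> (\<lambda>s. s j)))"
      by (rule integral_distr[symmetric, OF comp[OF that]]) auto
    also have "distr (\<Pi>\<^sub>M j\<in>{1::nat..}. \<mu>) \<mu> (\<lambda>s. s j) = \<mu>"
      by (rule distr_PiM_component) (use that N.prob_space_axioms in auto)
    finally show ?thesis by (simp add: pgf_def)
  qed
  have inner: "(\<integral>s. z ^ (\<Sum>j=1..k. s j) \<partial>(\<Pi>\<^sub>M j\<in>{1::nat..}. \<mu>)) = pgf \<mu> z ^ k" for k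
    unfolding power_sum
    by (subst  S.indep_vars_lebesgue_integral[OF _ ind]) (use int1 marg in auto)
  have int: "integrable (\<nu> \<Otimes>\<^sub>M (\<Pi>\<^sub>M j\<in>{1::nat..}. \<mu>)) (\<lambda>q. z ^ (case q of (k, s) \<Rightarrow> \<Sum>j=1..k. s j))"
    by (rule MP.P.integrable_const_bound[where B = 1])
      (use z measurable_compose[OF meas, of "\<lambda>k. z ^ k" borel] in \<open>auto simp: power_le_one\<close>)
  have "pgf (random_sum_law \<nu> \<mu>) z
      = (\<integral>q. z ^ (case q of (k, s) \<Rightarrow> \<Sum>j=1..k. s j) \<partial>(\<nu> \<Otimes>\<^sub>M (\<Pi>\<^sub>M j\<in>{1::nat..}. \<mu>)))"
    unfolding random_sum_law_def by (rule pgf_law[OF meas])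
  also have "\<dots> = (\<integral>k. \<integral>s. z ^ (\<Sum>j=1..k. s j) \<partial>(\<Pi>\<^sub>M j\<in>{1::nat..}. \<mu>) \<partial>\<nu>)"
    using MP.integral_fst'[OF int] by simp
  also have "\<dots> = pgf \<nu> (pgf \<mu> z)"
    unfolding inner by (simp add: pgf_def)
  finally show ?thesis .
qed

text \<open>The joint law of the counter and the sequence of summands is the product measure used in
  \<open>random_sum_law\<close>. \<open>W\<close> enumerates the indices of the summands inside a
  larger family.\<close>

lemma (in prob_space) law_random_sum:
  fixes Y :: "'i \<Rightarrow> 'a \<Rightarrow> nat"
  assumes ind: "indep_vars (\<lambda>_. count_space UNIV) Y (insert x (W ` {1::nat..}))"
    and W: "inj_on W {1..}" "x \<notin> W ` {1..}"
    and law: "\<And>i. i \<ge> 1 \<Longrightarrow> law M (Y (W i)) = \<mu>"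
  shows "law M (\<lambda>\<omega>. \<Sum>i=1..Y x \<omega>. Y (W i) \<omega>) = random_sum_law (law M (Y x)) \<mu>"
proof -
  let ?c = "count_space (UNIV :: nat set)"
  let ?J = "W ` {1::nat..}"
  let ?C = "\<Pi>\<^sub>M i\<in>{1::nat..}. ?c"
  have rv: "Y i \<in> measurable M ?c" if "i \<in> insert x ?J" for i
    using ind that by (auto simp: indep_vars_def)
  have nat: "nat_prob_space (law M (Y i))" if "i \<in> insert x ?J" for i
    using nat_prob_space_law[OF rv[OF that]] .
  have nat\<mu>: "nat_prob_space \<mu>"
    using nat[of "W 1"] law[of 1] by auto
  let ?S = "\<lambda>\<omega>. \<lambda>i\<in>{1::nat..}. Y (W i) \<omega>"
  let ?R = "\<lambda>I \<omega>. restrict (\<lambda>i. Y i \<omega>) I"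
  have ex: "(\<lambda>f. f x) \<in> measurable (PiM {x} (\<lambda>_. ?c)) ?c"
    by (rule measurable_component_singleton) auto
  have re: "(\<lambda>f. \<lambda>i\<in>{1..}. f (W i)) \<in> measurable (PiM ?J (\<lambda>_. ?c)) ?C"
    by (intro measurable_restrict measurable_component_singleton) auto
  have reS: "(\<lambda>f. \<lambda>i\<in>{1..}. f (W i)) \<circ> ?R ?J = ?S"
    by (auto simp: fun_eq_iff restrict_def)
  have R: "?R {x} \<in> measurable M (PiM {x} (\<lambda>_. ?c))"
    by (intro measurable_restrict rv) auto
  have J: "(\<lambda>\<omega>. restrict (\<lambda>i. Y i \<omega>) ?J) \<in> measurable M (PiM ?J (\<lambda>_. ?c))"
    by (intro measurable_restrict rv) auto
  have "indep_vars (\<lambda>_. ?c) Y ?J"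
    using ind by (rule indep_vars_subset) auto
  hence "distr M (PiM ?J (\<lambda>_. ?c)) (\<lambda>\<omega>. restrict (\<lambda>i. Y i \<omega>) ?J) = PiM ?J (\<lambda>i. law M (Y i))"
    by (subst (asm) indep_vars_iff_distr_eq_PiM') (auto intro: rv)
  \<comment> \<open>Renaming indices along \<open>W\<close> turns the product over \<open>?J\<close>
    into one over \<open>{1..}\<close>, in which every factor is \<mu>.\<close>
  hence "distr M ?C ?S = distr (PiM ?J (\<lambda>i. law M (Y i))) ?C (\<lambda>f. \<lambda>i\<in>{1..}. f (W i))"
    using distr_distr[OF re J] reS by simp
  also have "\<dots> = distr (PiM ?J (\<lambda>i. law M (Y i))) (\<Pi>\<^sub>M i\<in>{1..}. law M (Y (W i))) (\<lambda>f. \<lambda>i\<in>{1..}. f (W i))"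
    by (intro distr_cong sets_PiM_cong) auto
  also have "\<dots> = (\<Pi>\<^sub>M i\<in>{1..}. law M (Y (W i)))"
    by (rule distr_PiM_reindex) (use W nat in \<open>auto simp: nat_prob_space_def\<close>)
  also have "\<dots> = (\<Pi>\<^sub>M i\<in>{1..}. \<mu>)"
    by (intro PiM_cong refl law) auto
  finally have S: "distr M ?C ?S = (\<Pi>\<^sub>M i\<in>{1..}. \<mu>)" .
  \<comment> \<open>Both factors are written as images of restrictions of the family to
    \<open>{x}\<close> and \<open>?J\<close>, because independence of the two blocks is available at
    that level.\<close>
  have mapS: "(\<Pi>\<^sub>M i\<in>{1..}. \<mu>) = distr (distr M (PiM ?J (\<lambda>_. ?c)) (?R ?J)) ?C (\<lambda>f. \<lambda>i\<in>{1..}. f (W i))"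
    unfolding distr_distr[OF re J] reS S ..
  have mapx: "law M (Y x) = distr (distr M (PiM {x} (\<lambda>_. ?c)) (?R {x})) ?c (\<lambda>f. f x)"
    unfolding distr_distr[OF ex R] by (simp add: comp_def)
  have joint: "distr M (PiM {x} (\<lambda>_. ?c)) (?R {x}) \<Otimes>\<^sub>M distr M (PiM ?J (\<lambda>_. ?c)) (?R ?J)
      = distr M (PiM {x} (\<lambda>_. ?c) \<Otimes>\<^sub>M PiM ?J (\<lambda>_. ?c)) (\<lambda>\<omega>. (?R {x} \<omega>, ?R ?J \<omega>))"
    using indep_var_restrict[OF ind, of "{x}" ?J] W unfolding indep_var_distribution_eq by auto
  have sf: "sigma_finite_measure (\<Pi>\<^sub>M i\<in>{1::nat..}. \<mu>)"
    by (rule prob_space_imp_sigma_finite, rule prob_space_PiM)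
      (use nat\<mu> in \<open>auto simp: nat_prob_space_def\<close>)
  have RJ: "(\<lambda>\<omega>. (?R {x} \<omega>, ?R ?J \<omega>)) \<in> measurable M (PiM {x} (\<lambda>_. ?c) \<Otimes>\<^sub>M PiM ?J (\<lambda>_. ?c))"
    using R J by (rule measurable_Pair)
  have map: "(\<lambda>(f, g). (f x, \<lambda>i\<in>{1..}. g (W i)))
      \<in> measurable (PiM {x} (\<lambda>_. ?c) \<Otimes>\<^sub>M PiM ?J (\<lambda>_. ?c)) (?c \<Otimes>\<^sub>M ?C)"
    unfolding case_prod_beta
    by (intro measurable_Pair measurable_compose[OF measurable_fst ex] measurable_compose[OF measurable_snd re])
  have pair: "law M (Y x) \<Otimes>\<^sub>M (\<Pi>\<^sub>M i\<in>{1..}. \<mu>) = distr M (?c \<Otimes>\<^sub>M ?C) (\<lambda>\<omega>. (Y x \<omega>, ?S \<omega>))"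
  proof -
    have "law M (Y x) \<Otimes>\<^sub>M (\<Pi>\<^sub>M i\<in>{1..}. \<mu>)
        = distr (distr M (PiM {x} (\<lambda>_. ?c)) (?R {x}) \<Otimes>\<^sub>M distr M (PiM ?J (\<lambda>_. ?c)) (?R ?J)) (?c \<Otimes>\<^sub>M ?C)
            (\<lambda>(f, g). (f x, \<lambda>i\<in>{1..}. g (W i)))"
      unfolding mapx mapS by (rule pair_measure_distr) (use ex re sf mapS in simp_all)
    also have "\<dots> = distr M (?c \<Otimes>\<^sub>M ?C) ((\<lambda>(f, g). (f x, \<lambda>i\<in>{1..}. g (W i))) \<circ> (\<lambda>\<omega>. (?R {x} \<omega>, ?R ?J \<omega>)))"
      unfolding joint by (rule distr_distr[OF map RJ])
    also have "(\<lambda>(f, g). (f x, \<lambda>i\<in>{1..}. g (W i))) \<circ> (\<lambda>\<omega>. (?R {x} \<omega>, ?R ?J \<omega>)) = (\<lambda>\<omega>. (Y x \<omega>, ?S \<omega>))"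
      by (auto simp: fun_eq_iff restrict_def)
    finally show ?thesis .
  qed
  have meas: "(\<lambda>(k, s). \<Sum>j=1..k. s j) \<in> measurable (?c \<Otimes>\<^sub>M ?C) ?c"
    using random_sum_law_measurable[OF nat[of x] nat\<mu>] unfolding pair by simp
  have XS: "(\<lambda>\<omega>. (Y x \<omega>, ?S \<omega>)) \<in> measurable M (?c \<Otimes>\<^sub>M ?C)"
    using measurable_compose[OF RJ map] by (simp add: restrict_def cong: if_cong)
  \<comment> \<open>The sum reads only positive positions, where the restricted sequence
    \<open>?S\<close> agrees with the summands.\<close>
  show ?thesis
    unfolding random_sum_law_def pair distr_distr[OF meas XS]
    by (rule arg_cong[where f = "law M"]) (auto simp: fun_eq_iff intro!: sum.cong)
qed

lemma (in prob_space) pgf_indep_sum: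
  fixes T :: "'i \<Rightarrow> 'a \<Rightarrow> nat"
  assumes ind: "indep_vars (\<lambda>_. count_space UNIV) T I" and "finite I" and z: "0 \<le> z" "z \<le> 1"
  shows "(\<integral>\<omega>. z ^ (\<Sum>i\<in>I. T i \<omega>) \<partial>M) = (\<Prod>i\<in>I. pgf (law M (T i)) z)"
proof -
  have rv: "T i \<in> measurable M (count_space UNIV)" if "i \<in> I" for i
    using ind that by (auto simp: indep_vars_def)
  have ind': "indep_vars (\<lambda>_. borel) (\<lambda>i \<omega>. z ^ T i \<omega>) I"
    by (rule indep_vars_compose2[OF ind]) auto
  have int: "integrable M (\<lambda>\<omega>. z ^ T i \<omega>)" if "i \<in> I" for i
    by (rule integrable_const_bound[where B = 1])
       (use z measurable_compose[OF rv[OF that], of "\<lambda>k. z ^ k" borel] in \<open>auto simp: power_le_one\<close>)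
  have "(\<integral>\<omega>. z ^ (\<Sum>i\<in>I. T i \<omega>) \<partial>M) = (\<Prod>i\<in>I. \<integral>\<omega>. z ^ T i \<omega> \<partial>M)"
    unfolding power_sum by (rule indep_vars_lebesgue_integral) (use assms ind' int in auto)
  also have "\<dots> = (\<Prod>i\<in>I. pgf (law M (T i)) z)"
    by (intro prod.cong refl) (simp add: pgf_law[OF rv])
  finally show ?thesis .
qed

subsection \<open>The fixed point\<close>

text \<open>Each application shrinks the distance to 1 by a factor of at most \<open>b\<close>. The
  distance is at most 1 at the start, hence at most \<open>b ^ n\<close> after \<open>n\<close>
  steps.\<close>

lemma (in nat_prob_space) tendsto_iterate_pgf:
  assumes int: "integrable \<mu> real" and b: "(\<integral>k. real k \<partial>\<mu>) \<le> b" "b < 1"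
    and z: "0 \<le> z" "z \<le> 1"
  shows "(pgf \<mu> ^^ n) z \<in> {0..1}" and "(\<lambda>n. (pgf \<mu> ^^ n) z) \<longlonglongrightarrow> 1"
proof -
  have rng: "(pgf \<mu> ^^ n) z \<in> {0..1}" for n
    by (induction n) (use z in \<open>auto simp: pgf_nonneg pgf_le_1\<close>)
  thus "(pgf \<mu> ^^ n) z \<in> {0..1}" .
  \<comment> \<open>Nonnegativity of the mean gives \<open>0 \<le> b\<close>, which both the
    induction step and the convergence of \<open>b ^ n\<close> use.\<close>
  have "0 \<le> (\<integral>k. real k \<partial>\<mu>)" by simp
  hence b0: "0 \<le> b" using b by linarith
  have "1 - (pgf \<mu> ^^ n) z \<le> b ^ n" for n
  proof (induction n)
    case (Suc n)
    let ?w = "(pgf \<mu> ^^ n) z"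
    have "1 - pgf \<mu> ?w \<le> (\<integral>k. real k \<partial>\<mu>) * (1 - ?w)"
      using rng[of n] by (intro one_minus_pgf_le int) auto
    also have "\<dots> \<le> b * b ^ n"
      using Suc b b0 rng[of n] by (intro mult_mono) auto
    finally show ?case by simp
  qed (use z in simp)
  hence "norm ((pgf \<mu> ^^ n) z - 1) \<le> b ^ n" for n
    using rng[of n] by (simp add: abs_minus_commute)
  moreover have "(\<lambda>n. b ^ n) \<longlonglongrightarrow> 0"
    using b0 b by (intro LIMSEQ_power_zero) auto
  ultimately have "(\<lambda>n. (pgf \<mu> ^^ n) z - 1) \<longlonglongrightarrow> 0"
    by (rule Lim_null_comparison[OF always_eventually[OF allI]])
  thus "(\<lambda>n. (pgf \<mu> ^^ n) z) \<longlonglongrightarrow> 1"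
    by (simp add: LIM_zero_iff)
qed

text \<open>The equation is substituted into itself, each time splitting off the factor at the
  current iterate. The iterates stay in [0,1], where the equation holds.\<close>

lemma fixed_point_pgf_iterate:
  assumes "\<And>z. z \<in> {0..1} \<Longrightarrow> pgf \<xi> z = pgf \<alpha> z * pgf \<xi> (\<phi> z)"
    and "\<And>n. (\<phi> ^^ n) z \<in> {0..1::real}"
  shows "pgf \<xi> z = (\<Prod>m<n. pgf \<alpha> ((\<phi> ^^ m) z)) * pgf \<xi> ((\<phi> ^^ n) z)"
proof (induction n)
  case (Suc n)
  thus ?case using assms(1)[OF assms(2), of n] by (simp add: mult.assoc)
qed simp

text \<open>\<open>Y a\<close> and the random sum are functions of disjoint blocks of an independent
  family, so the generating function factorises. With the indices \<open>InA\<close>,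
  \<open>InX\<close>, \<open>InB\<close> this is the right-hand side of the fixed-point
  equation.\<close>

lemma (in prob_space) pgf_add_random_sum:
  fixes Y :: "'i \<Rightarrow> 'a \<Rightarrow> nat"
  assumes ind: "indep_vars (\<lambda>_. count_space UNIV) Y (insert a (insert x (W ` {1::nat..})))"
    and W: "inj_on W {1..}" "x \<notin> W ` {1..}" "a \<noteq> x" "a \<notin> W ` {1..}"
    and law: "\<And>i. i \<ge> 1 \<Longrightarrow> law M (Y (W i)) = \<mu>"
    and z: "0 \<le> z" "z \<le> 1"
  shows "pgf (law M (\<lambda>\<omega>. Y a \<omega> + (\<Sum>i=1..Y x \<omega>. Y (W i) \<omega>))) z
    = pgf (law M (Y a)) z * pgf (law M (Y x)) (pgf \<mu> z)"
proof -
  let ?c = "count_space (UNIV :: nat set)"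
  let ?J = "insert x (W ` {1::nat..})"
  let ?S = "\<lambda>\<omega>. \<Sum>i=1..Y x \<omega>. Y (W i) \<omega>"
  have rv: "Y i \<in> measurable M ?c" if "i \<in> insert a ?J" for i
    using ind that by (auto simp: indep_vars_def)
  have S: "?S \<in> measurable M ?c"
    by (rule measurable_random_sum) (use rv in auto)
  have "indep_var (PiM {a} (\<lambda>_. ?c)) (\<lambda>\<omega>. restrict (\<lambda>i. Y i \<omega>) {a})
      (PiM ?J (\<lambda>_. ?c)) (\<lambda>\<omega>. restrict (\<lambda>i. Y i \<omega>) ?J)"
    by (rule indep_var_restrict[OF ind]) (use W in auto)
  moreover have "(\<lambda>f. f a) \<in> measurable (PiM {a} (\<lambda>_. ?c)) ?c"
    by (rule measurable_component_singleton) auto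
  moreover have "(\<lambda>f. \<Sum>i=1..f x. f (W i)) \<in> measurable (PiM ?J (\<lambda>_. ?c)) ?c"
    by (rule measurable_random_sum[where Y = "\<lambda>i f. f i"])
      (auto intro!: measurable_component_singleton)
  ultimately have "indep_var ?c ((\<lambda>f. f a) \<circ> (\<lambda>\<omega>. restrict (\<lambda>i. Y i \<omega>) {a}))
      ?c ((\<lambda>f. \<Sum>i=1..f x. f (W i)) \<circ> (\<lambda>\<omega>. restrict (\<lambda>i. Y i \<omega>) ?J))"
    by (rule indep_var_compose)
  moreover have "(\<lambda>f. \<Sum>i=1..f x. f (W i)) \<circ> (\<lambda>\<omega>. restrict (\<lambda>i. Y i \<omega>) ?J) = ?S"
    by (auto simp: fun_eq_iff)
  moreover have "(\<lambda>f. f a) \<circ> (\<lambda>\<omega>. restrict (\<lambda>i. Y i \<omega>) {a}) = Y a"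
    by (auto simp: fun_eq_iff)
  ultimately have "indep_var ?c (Y a) ?c ?S" by simp
  \<comment> \<open>Two independent variables form a family indexed by \<open>bool\<close>; once the
    target space is constant, the product formula for finite families applies.\<close>
  hence "indep_vars (\<lambda>_. ?c) (case_bool (Y a) ?S) UNIV"
    unfolding indep_var_def by (rule iffD1[OF indep_vars_cong, rotated -1]) (auto split: bool.split)
  from pgf_indep_sum[OF this _ z]
  have "(\<integral>\<omega>. z ^ (Y a \<omega> + ?S \<omega>) \<partial>M) = pgf (law M (Y a)) z * pgf (law M ?S) z"
    by (simp add: UNIV_bool mult.commute add.commute)
  also have "law M ?S = random_sum_law (law M (Y x)) \<mu>"
    by (rule law_random_sum[where Y = Y, OF indep_vars_subset[OF ind]]) (use W law in auto)
  also have "pgf \<dots> z = pgf (law M (Y x)) (pgf \<mu> z)"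
    using nat_prob_space_law[OF rv, of x] nat_prob_space_law[OF rv, of "W 1"] law[of 1] z
    by (intro pgf_random_sum_law) auto
  moreover have "(\<lambda>\<omega>. Y a \<omega> + ?S \<omega>) \<in> measurable M ?c"
    by (rule measurable_compose_countable[where g = "Y a", OF measurable_compose[OF S]])
      (use rv in auto)
  ultimately show ?thesis by (simp add: pgf_law)
qed

section \<open>Series of natural numbers\<close>

text \<open>The topology on \<open>nat\<close> is discrete, so convergent partial sums are
  eventually constant.\<close>

lemma summable_nat_iff: "summable (f :: nat \<Rightarrow> nat) \<longleftrightarrow> (\<exists>n. \<forall>m\<ge>n. f m = 0)"
proof
  assume "summable f"
  then obtain s where "(\<lambda>n. \<Sum>i<n. f i) \<longlonglongrightarrow> s"
    by (auto simp: summable_def sums_def)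
  then obtain n where n: "\<And>m. m \<ge> n \<Longrightarrow> (\<Sum>i<m. f i) = s"
    by (auto simp: tendsto_discrete eventually_sequentially)
  have "f m = 0" if "m \<ge> n" for m
    using n[of m] n[of "Suc m"] that by simp
  thus "\<exists>n. \<forall>m\<ge>n. f m = 0" by blast
next
  assume "\<exists>n. \<forall>m\<ge>n. f m = 0"
  then obtain n where "\<forall>m\<ge>n. f m = 0" ..
  thus "summable f" by (intro summable_finite[of "{..<n}"]) (auto simp: not_less)
qed

lemma suminf_nat_eq: "\<forall>m\<ge>n. f m = 0 \<Longrightarrow> suminf f = (\<Sum>m<n. f m :: nat)"
  by (rule suminf_finite) (auto simp: not_less)

text \<open>Being eventually zero is a countable combination of events about single terms; the level
  sets of the sum reduce to such events and finite sums.\<close>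

lemma measurable_suminf_nat:
  fixes f :: "nat \<Rightarrow> 'a \<Rightarrow> nat"
  assumes [measurable]: "\<And>m. f m \<in> measurable P (count_space UNIV)"
  shows "(\<lambda>\<omega>. \<Sum>m. f m \<omega>) \<in> measurable P (count_space UNIV)"
    and "{\<omega> \<in> space P. summable (\<lambda>m. f m \<omega>)} \<in> sets P"
proof -
  show "{\<omega> \<in> space P. summable (\<lambda>m. f m \<omega>)} \<in> sets P"
    unfolding summable_nat_iff by measurable
  \<comment> \<open>\<open>suminf\<close> is a definite description, so without a limit it is
    \<open>THE s. False\<close>, the same constant at every divergent sample point.\<close>
  define c where "c = (THE s :: nat. False)"
  have div: "(\<Sum>m. f m \<omega>) = c" if "\<not> summable (\<lambda>m. f m \<omega>)" for \<omega>
    using that by (simp add: suminf_def summable_def c_def)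
  have *: "(\<Sum>m. f m \<omega>) = k \<longleftrightarrow>
      (\<exists>n. (\<forall>m\<ge>n. f m \<omega> = 0) \<and> (\<Sum>m<n. f m \<omega>) = k) \<or> (\<not> (\<exists>n. \<forall>m\<ge>n. f m \<omega> = 0) \<and> c = k)"
    for \<omega> k
  proof (cases "summable (\<lambda>m. f m \<omega>)")
    case True
    thus ?thesis using suminf_nat_eq[of _ "\<lambda>m. f m \<omega>"] unfolding summable_nat_iff by auto
  next
    case False
    thus ?thesis using div[OF False] unfolding summable_nat_iff by blast
  qed
  show "(\<lambda>\<omega>. \<Sum>m. f m \<omega>) \<in> measurable P (count_space UNIV)"
  proof (rule measurable_count_space_eq2_countable[THEN iffD2])
    have "Measurable.pred P (\<lambda>\<omega>. (\<Sum>m. f m \<omega>) = k)" for k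
      unfolding * by measurable
    hence "{\<omega> \<in> space P. (\<Sum>m. f m \<omega>) = k} \<in> sets P" for k
      by simp
    moreover have "(\<lambda>\<omega>. \<Sum>m. f m \<omega>) -` {k} \<inter> space P = {\<omega> \<in> space P. (\<Sum>m. f m \<omega>) = k}" for k
      by auto
    ultimately show "(\<lambda>\<omega>. \<Sum>m. f m \<omega>) \<in> space P \<rightarrow> UNIV \<and>
      (\<forall>k\<in>UNIV. (\<lambda>\<omega>. \<Sum>m. f m \<omega>) -` {k} \<inter> space P \<in> sets P)" by simp
  qed
qed

text \<open>Along divergent sample points \<open>z ^ S\<^sub>n\<close> tends to \<open>0\<close>, so the limiting generating
  function only sees the convergent ones, and letting \<open>z\<close> tend to \<open>1\<close> gives their probability.\<close>

lemma (in prob_space) sum_law_eqI_pgf_limit: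
  fixes T :: "nat \<Rightarrow> 'a \<Rightarrow> nat"
  assumes T: "\<And>m. T m \<in> measurable M (count_space UNIV)" and \<xi>: "nat_prob_space \<xi>"
    and lim: "\<And>z. 0 < z \<Longrightarrow> z < 1 \<Longrightarrow> (\<lambda>n. \<integral>\<omega>. z ^ (\<Sum>m<n. T m \<omega>) \<partial>M) \<longlonglongrightarrow> pgf \<xi> z"
  shows "AE \<omega> in M. summable (\<lambda>m. T m \<omega>)" and "\<xi> = law M (\<lambda>\<omega>. \<Sum>m. T m \<omega>)"
proof -
  interpret X: nat_prob_space \<xi> by fact
  note [measurable] = T measurable_suminf_nat[OF T]
  define F where "F = {\<omega> \<in> space M. summable (\<lambda>m. T m \<omega>)}"
  have F [measurable]: "F \<in> sets M" unfolding F_def by measurable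
  define Y where "Y = (\<lambda>\<omega>. \<Sum>m. T m \<omega>)"
  have Y [measurable]: "Y \<in> measurable M (count_space UNIV)" unfolding Y_def by measurable
  have ptw: "(\<lambda>n. z ^ (\<Sum>m<n. T m \<omega>)) \<longlonglongrightarrow> indicator F \<omega> * z ^ Y \<omega>"
    if z: "0 < z" "z < 1" and \<omega>: "\<omega> \<in> space M" for z :: real and \<omega>
  proof (cases "\<omega> \<in> F")
    case True
    then obtain n where n: "\<forall>m\<ge>n. T m \<omega> = 0" by (auto simp: F_def summable_nat_iff)
    have "(\<Sum>m<k. T m \<omega>) = Y \<omega>" if "k \<ge> n" for k
      unfolding Y_def using n that by (intro suminf_nat_eq[symmetric]) auto
    hence "eventually (\<lambda>k. z ^ (\<Sum>m<k. T m \<omega>) = indicator F \<omega> * z ^ Y \<omega>) sequentially"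
      using True unfolding eventually_sequentially by (intro exI[of _ n]) simp
    thus ?thesis by (rule tendsto_eventually)
  next
    case False
    \<comment> \<open>Outside \<open>F\<close> nonzero terms recur forever and each adds at least 1,
      so the partial sums pass every level.\<close>
    have "filterlim (\<lambda>n. \<Sum>m<n. T m \<omega>) at_top sequentially"
      unfolding filterlim_at_top
    proof
      fix k
      show "eventually (\<lambda>n. k \<le> (\<Sum>m<n. T m \<omega>)) sequentially"
      proof (induction k)
        case (Suc k)
        then obtain n where n: "k \<le> (\<Sum>m<n. T m \<omega>)"
          by (auto simp: eventually_sequentially)
        obtain p where p: "p \<ge> n" "T p \<omega> \<noteq> 0"
          using False \<omega> by (auto simp: F_def summable_nat_iff)
        have "Suc k \<le> (\<Sum>m<q. T m \<omega>)" if "q \<ge> Suc p" for q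
        proof -
          have "Suc k \<le> (\<Sum>m<n. T m \<omega>) + T p \<omega>" using n p by simp
          also have "\<dots> \<le> (\<Sum>m<p. T m \<omega>) + T p \<omega>"
            using p by (intro add_mono sum_mono2) auto
          also have "\<dots> = (\<Sum>m<Suc p. T m \<omega>)" by simp
          also have "\<dots> \<le> (\<Sum>m<q. T m \<omega>)"
            using that by (intro sum_mono2) auto
          finally show ?thesis .
        qed
        thus ?case by (auto simp: eventually_sequentially)
      qed simp
    qed
    moreover have "(\<lambda>n. z ^ n) \<longlonglongrightarrow> 0" using z by (intro LIMSEQ_power_zero) auto
    ultimately show ?thesis
      using False filterlim_compose by fastforce
  qed
  have eqF: "(\<integral>\<omega>. indicator F \<omega> * z ^ Y \<omega> \<partial>M) = pgf \<xi> z" if z: "0 < z" "z < 1" for z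
  proof (rule LIMSEQ_unique[OF _ lim[OF z]])
    show "(\<lambda>n. \<integral>\<omega>. z ^ (\<Sum>m<n. T m \<omega>) \<partial>M) \<longlonglongrightarrow> (\<integral>\<omega>. indicator F \<omega> * z ^ Y \<omega> \<partial>M)"
      by (rule integral_dominated_convergence[where w = "\<lambda>_. 1"])
        (use z ptw[OF z] in \<open>auto simp: power_le_one\<close>)
  qed
  \<comment> \<open>The shift by 2 makes the sequence start at 1/2, so that it stays strictly inside
    (0,1), where \<open>eqF\<close> holds, while tending to 1.\<close>
  define x where "x n = 1 - 1 / real (n + 2)" for n
  have x: "0 < x n" "x n < 1" for n by (auto simp: x_def field_simps)
  have xlim: "x \<longlonglongrightarrow> 1"
    unfolding x_def by real_asymp
  have xpow: "(\<lambda>n. x n ^ k) \<longlonglongrightarrow> 1" for k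
    using tendsto_power[OF xlim, of k] by simp
  have "(\<lambda>n. pgf \<xi> (x n)) \<longlonglongrightarrow> pgf \<xi> 1"
    using x xlim by (intro X.tendsto_pgf less_imp_le)
  moreover have "(\<lambda>n. \<integral>\<omega>. indicator F \<omega> * x n ^ Y \<omega> \<partial>M) \<longlonglongrightarrow> (\<integral>\<omega>. indicator F \<omega> * 1 ^ Y \<omega> \<partial>M)"
    by (rule integral_dominated_convergence[where w = "\<lambda>_. 1"])
      (use x xpow in \<open>auto simp: power_le_one less_imp_le indicator_def\<close>)
  \<comment> \<open>As \<open>z\<close> tends to 1 the two sides of \<open>eqF\<close> tend to
    \<open>prob F\<close> and to \<open>pgf \<xi> 1 = 1\<close>: no mass escapes to
    infinity.\<close>
  ultimately have "prob F = 1"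
    using LIMSEQ_unique by (fastforce simp: eqF x)
  hence AE: "AE \<omega> in M. \<omega> \<in> F" using prob_eq_1[OF F] by simp
  thus "AE \<omega> in M. summable (\<lambda>m. T m \<omega>)" by (auto simp: F_def)
  have "pgf \<xi> z = pgf (law M Y) z" if z: "0 < z" "z < 1" for z
  proof -
    have "(\<integral>\<omega>. indicator F \<omega> * z ^ Y \<omega> \<partial>M) = (\<integral>\<omega>. z ^ Y \<omega> \<partial>M)"
      by (rule integral_cong_AE) (use AE in \<open>auto\<close>)
    thus ?thesis using eqF[OF z] by (simp add: pgf_law)
  qed
  hence "\<xi> = law M Y"
    by (intro nat_measure_eqI_pgf \<xi> nat_prob_space_law Y)
  thus "\<xi> = law M (\<lambda>\<omega>. \<Sum>m. T m \<omega>)" by (simp add: Y_def)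
qed

section \<open>The representation of the fixed point\<close>

theorem lemma3p4:
  fixes M :: "'a measure" and N :: "'b measure"
    and A B X' :: "'a \<Rightarrow> nat" and Bs :: "nat \<Rightarrow> 'a \<Rightarrow> nat"
    and X :: "'b \<Rightarrow> nat"
    and L :: "real \<Rightarrow> real" and \<epsilon> b :: real
    and D_law :: "nat \<Rightarrow> nat measure"
  assumes M: "prob_space M" and N: "prob_space N"
    and B_rv: "B \<in> measurable M (count_space UNIV)"
    and X_rv: "X \<in> measurable N (count_space UNIV)"
    and Bs_law: "\<And>i. i \<ge> 1 \<Longrightarrow> law M (Bs i) = law M B"
    and X'_law: "law M X' = law N X"
    and indep: "prob_space.indep_vars M (\<lambda>_. count_space UNIV)
        (\<lambda>k. case k of InX \<Rightarrow> X' | InA \<Rightarrow> A | InB i \<Rightarrow> Bs i)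
        ({InX, InA} \<union> InB ` {1..})"
    and A_tail: "(\<lambda>x::real. measure M {\<omega> \<in> space M. real (A \<omega>) > x})
        \<sim>[at_top] (\<lambda>x. inverse (1 + x))"
    and B_tail: "\<And>x::real. x > 0 \<Longrightarrow>
        measure M {\<omega> \<in> space M. real (B \<omega>) > x} = L x / (1 + x)"
    and L_sv: "slowly_varying L"
    and eps: "\<epsilon> > 0"
    and L_asymp: "L \<sim>[at_top] (\<lambda>x. ln x powr (- 1 - \<epsilon>))"
    and B_mean: "has_bochner_integral M (\<lambda>\<omega>. real (B \<omega>)) b"
    and b: "0 < b" "b < 1"
    and fixed_point: "law N X = law M (\<lambda>\<omega>. A \<omega> + (\<Sum>i=1..X' \<omega>. Bs i \<omega>))"
    and D_law_1: "D_law 1 = law M B"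
    and D_law_Suc: "\<And>n. n \<ge> 1 \<Longrightarrow> D_law (n + 1) = random_sum_law (law M B) (D_law n)"
  shows "\<exists>(\<Omega> :: (output_index \<Rightarrow> nat) measure)
            (A' :: (output_index \<Rightarrow> nat) \<Rightarrow> nat)
            (As :: nat \<Rightarrow> (output_index \<Rightarrow> nat) \<Rightarrow> nat)
            (D :: nat \<Rightarrow> nat \<Rightarrow> (output_index \<Rightarrow> nat) \<Rightarrow> nat).
      prob_space \<Omega> \<and>
      law \<Omega> A' = law M A \<and>
      (\<forall>n\<ge>1. law \<Omega> (As n) = law M A) \<and>
      prob_space.indep_vars \<Omega> (\<lambda>_. count_space UNIV) As {1..} \<and>
      (\<forall>n\<ge>1. \<forall>i\<ge>1. law \<Omega> (D n i) = D_law n) \<and>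
      prob_space.indep_vars \<Omega> (\<lambda>_. count_space UNIV)
        (\<lambda>k. case k of OutA \<Rightarrow> A' | OutAs n \<Rightarrow> As n | OutD n i \<Rightarrow> D n i)
        ({OutA} \<union> {OutAs (n + 1) |n. n \<ge> 1} \<union> {OutD n i |n i. n \<ge> 1 \<and> i \<ge> 1}) \<and>
      (AE \<omega> in \<Omega>. summable (\<lambda>m. \<Sum>i=1..As (Suc m + 1) \<omega>. D (Suc m) i \<omega>)) \<and>
      law N X = law \<Omega> (\<lambda>\<omega>. A' \<omega> + (\<Sum>m. \<Sum>i=1..As (Suc m + 1) \<omega>. D (Suc m) i \<omega>))"
proof -
  interpret M: prob_space M by fact
  interpret N: prob_space N by fact
  let ?c = "count_space (UNIV :: nat set)"
  let ?\<alpha> = "law M A" and ?\<beta> = "law M B" and ?\<xi> = "law N X"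
  define Y where "Y = (\<lambda>k. case k of InX \<Rightarrow> X' | InA \<Rightarrow> A | InB i \<Rightarrow> Bs i)"
  have Yind: "M.indep_vars (\<lambda>_. ?c) Y (insert InA (insert InX (InB ` {1..})))"
    using indep unfolding Y_def by (rule M.indep_vars_subset) auto
  have Y: "Y k \<in> measurable M ?c" if "k \<in> insert InA (insert InX (InB ` {1..}))" for k
    using Yind that by (auto simp: M.indep_vars_def)
  have A: "A \<in> measurable M ?c"
    using Y[of InA] by (simp add: Y_def)
  interpret \<alpha>: nat_prob_space ?\<alpha> by (rule M.nat_prob_space_law[OF A])
  interpret \<beta>: nat_prob_space ?\<beta> by (rule M.nat_prob_space_law[OF B_rv])
  interpret \<xi>: nat_prob_space ?\<xi> by (rule N.nat_prob_space_law[OF X_rv])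

  \<comment> \<open>The functional equation and its infinite product\<close>
  have Bint: "integrable ?\<beta> real" "(\<integral>k. real k \<partial>?\<beta>) = b"
    using B_mean B_rv
    by (auto simp: integrable_distr_eq integral_distr has_bochner_integral_iff)
  note iter = \<beta>.tendsto_iterate_pgf[OF Bint(1) eq_refl[OF Bint(2)] b(2)]
  let ?\<phi> = "\<lambda>n. pgf ?\<beta> ^^ n"
  \<comment> \<open>\<open>X'\<close> is a copy of \<open>X\<close> on the space of \<open>A\<close>
    and \<open>Bs\<close>; it has the same law, so \<open>pgf ?\<xi>\<close> appears on both
    sides.\<close>
  have fp: "pgf ?\<xi> z = pgf ?\<alpha> z * pgf ?\<xi> (pgf ?\<beta> z)" if "z \<in> {0..1}" for z
  proof -
    have "pgf (law M (\<lambda>\<omega>. Y InA \<omega> + (\<Sum>i=1..Y InX \<omega>. Y (InB i) \<omega>))) z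
        = pgf (law M (Y InA)) z * pgf (law M (Y InX)) (pgf ?\<beta> z)"
      by (rule M.pgf_add_random_sum[where Y = Y, OF Yind])
        (use that Bs_law in \<open>auto simp: Y_def inj_on_def\<close>)
    thus ?thesis using fixed_point X'_law by (simp add: Y_def)
  qed
  \<comment> \<open>The iterated equation is divided by \<open>?g n\<close>, which tends to 1 and
    hence is eventually nonzero; what remains is the partial product.\<close>
  have lim: "(\<lambda>n. \<Prod>m<n. pgf ?\<alpha> (?\<phi> m z)) \<longlonglongrightarrow> pgf ?\<xi> z" if z: "0 < z" "z < 1" for z
  proof -
    let ?g = "\<lambda>n. pgf ?\<xi> (?\<phi> n z)"
    have z': "0 \<le> z" "z \<le> 1" using z by auto
    have g: "?g \<longlonglongrightarrow> 1"
      using \<xi>.tendsto_pgf[OF _ _ iter(2)[OF z']] iter(1)[OF z'] by simp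
    hence "(\<lambda>n. pgf ?\<xi> z / ?g n) \<longlonglongrightarrow> pgf ?\<xi> z / 1"
      by (intro tendsto_intros) auto
    moreover have "eventually (\<lambda>n. pgf ?\<xi> z / ?g n = (\<Prod>m<n. pgf ?\<alpha> (?\<phi> m z))) sequentially"
      using tendsto_imp_eventually_ne[OF g, of 0]
    proof (rule eventually_mono)
      fix n assume "?g n \<noteq> 0"
      thus "pgf ?\<xi> z / ?g n = (\<Prod>m<n. pgf ?\<alpha> (?\<phi> m z))"
        using fixed_point_pgf_iterate[OF fp iter(1)[OF z'], of n] by (simp add: field_simps)
    qed simp
    ultimately show ?thesis by (auto intro: Lim_transform_eventually)
  qed

  \<comment> \<open>Indexed by \<open>Suc n\<close> because \<open>D_law\<close> is specified from 1
    on. A further generation, with counter law \<open>?\<beta>\<close>, applies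
    \<open>pgf ?\<beta>\<close> once more on the outside.\<close>
  have D: "nat_prob_space (D_law (Suc n)) \<and> (\<forall>z\<in>{0..1}. pgf (D_law (Suc n)) z = ?\<phi> (Suc n) z)" for n
  proof (induction n)
    case 0
    show ?case using D_law_1 \<beta>.nat_prob_space_axioms by simp
  next
    case (Suc n)
    hence "D_law (Suc (Suc n)) = random_sum_law ?\<beta> (D_law (Suc n))"
      using D_law_Suc[of "Suc n"] by simp
    thus ?case
      using Suc nat_prob_space_random_sum_law[OF \<beta>.nat_prob_space_axioms]
      by (simp add: pgf_random_sum_law[OF \<beta>.nat_prob_space_axioms])
  qed

  \<comment> \<open>The product space carrying the output variables\<close>
  define \<Lambda> where "\<Lambda> = (\<lambda>k. case k of OutA \<Rightarrow> ?\<alpha> | OutAs n \<Rightarrow> ?\<alpha>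
      | OutD n i \<Rightarrow> if n \<ge> 1 then D_law n else ?\<alpha>)"
  \<comment> \<open>The default \<open>?\<alpha>\<close> at \<open>OutD 0 i\<close> matters here:
    \<open>D_law 0\<close> is unspecified, while the product over all indices needs a probability
    measure at each of them.\<close>
  have \<Lambda>: "nat_prob_space (\<Lambda> k)" for k
    using D \<alpha>.nat_prob_space_axioms by (auto simp: \<Lambda>_def Suc_le_D split: output_index.split dest!: Suc_le_D)
  define \<Omega> where "\<Omega> = PiM UNIV \<Lambda>"
  have \<Lambda>p: "prob_space (\<Lambda> k)" and \<Lambda>s: "sets (\<Lambda> k) = sets ?c" for k
    using \<Lambda>[of k] by (auto simp: nat_prob_space_def nat_prob_space_axioms_def)
  interpret \<Omega>: prob_space \<Omega>
    unfolding \<Omega>_def by (rule prob_space_PiM) (rule \<Lambda>p)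
  have coord: "(\<lambda>\<omega>. \<omega> k) \<in> measurable \<Omega> ?c" for k
    unfolding \<Omega>_def measurable_cong_sets[OF refl \<Lambda>s[symmetric, of k]]
    by (rule measurable_component_singleton) simp
  have law\<Lambda>: "law \<Omega> (\<lambda>\<omega>. \<omega> k) = \<Lambda> k" for k
  proof -
    have "law \<Omega> (\<lambda>\<omega>. \<omega> k) = distr \<Omega> (\<Lambda> k) (\<lambda>\<omega>. \<omega> k)"
      by (rule distr_cong) (auto simp: \<Lambda>s)
    thus ?thesis unfolding \<Omega>_def by (simp add: distr_PiM_component \<Lambda>p)
  qed
  \<comment> \<open>Composition with the identity replaces the target \<open>\<Lambda> (f i)\<close>
    by the counting space, which has the same measurable sets.\<close>
  have ind: "\<Omega>.indep_vars (\<lambda>_. ?c) (\<lambda>i \<omega>. \<omega> (f i)) I" if "inj_on f I" "I \<noteq> {}" for f :: "'i \<Rightarrow> output_index" and I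
  proof -
    have "\<Omega>.indep_vars (\<lambda>i. \<Lambda> (f i)) (\<lambda>i \<omega>. \<omega> (f i)) I"
      unfolding \<Omega>_def by (rule indep_vars_PiM_coordinates) (use that \<Lambda>p in auto)
    thus ?thesis
      by (rule \<Omega>.indep_vars_compose2[where Y = "\<lambda>_ x. x"])
        (simp add: measurable_cong_sets[OF \<Lambda>s refl])
  qed

  \<comment> \<open>The terms of the series, their independence and their laws\<close>
  define K where "K m = (case m of 0 \<Rightarrow> {OutA}
    | Suc m \<Rightarrow> insert (OutAs (Suc m + 1)) (OutD (Suc m) ` {1..}))" for m
  \<comment> \<open>Term 0 is \<open>A\<close>; for \<open>m \<ge> 1\<close>, term \<open>m\<close>
    has counter \<open>OutAs (m + 1)\<close> and summands \<open>OutD m i\<close>. With this shift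
    the generating function of every \<open>T m\<close> is \<open>pgf ?\<alpha>\<close> at the
    \<open>m\<close>-th iterate, \<open>m = 0\<close> included.\<close>
  define T where "T m \<omega> = (case m of 0 \<Rightarrow> \<omega> OutA
    | Suc m \<Rightarrow> \<Sum>i=1..\<omega> (OutAs (Suc m + 1)). \<omega> (OutD (Suc m) i))" for m and \<omega> :: "output_index \<Rightarrow> nat"
  \<comment> \<open>\<open>P\<close> is left open because measurability is needed on \<Omega> and
    again on the product over the block \<open>K m\<close>.\<close>
  have Tmeas: "T m \<in> measurable P ?c" if "\<And>k. k \<in> K m \<Longrightarrow> (\<lambda>\<omega>. \<omega> k) \<in> measurable P ?c" for m P
  proof (cases m)
    case 0
    thus ?thesis using that[of OutA] by (simp add: T_def[abs_def] K_def)
  next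
    case (Suc j)
    have "(\<lambda>\<omega>. \<Sum>i=1..\<omega> (OutAs (Suc j + 1)). \<omega> (OutD (Suc j) i)) \<in> measurable P ?c"
      by (rule measurable_random_sum[where Y = "\<lambda>k \<omega>. \<omega> k"]) (use that Suc in \<open>auto simp: K_def\<close>)
    thus ?thesis using Suc by (simp add: T_def[abs_def])
  qed
  have T: "T m \<in> measurable \<Omega> ?c" for m
    by (rule Tmeas) (rule coord)
  \<comment> \<open>The blocks \<open>K m\<close> are disjoint, and \<open>T m\<close> reads
    coordinates of its own block only, so restricting to that block does not change it.\<close>
  have Tind: "\<Omega>.indep_vars (\<lambda>_. ?c) T UNIV"
  proof -
    have "\<Omega>.indep_vars (\<lambda>m. PiM (K m) (\<lambda>_. ?c)) (\<lambda>m \<omega>. restrict (\<lambda>k. \<omega> k) (K m)) UNIV"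
      by (rule \<Omega>.indep_vars_restrict[OF ind[of "\<lambda>k. k" UNIV]])
        (auto simp: K_def disjoint_family_on_def split: nat.split)
    hence "\<Omega>.indep_vars (\<lambda>_. ?c) (\<lambda>m \<omega>. T m (restrict (\<lambda>k. \<omega> k) (K m))) UNIV"
      by (rule \<Omega>.indep_vars_compose2) (rule Tmeas, rule measurable_component_singleton)
    also have "(\<lambda>m \<omega>. T m (restrict (\<lambda>k. \<omega> k) (K m))) = T"
      by (auto simp: fun_eq_iff T_def K_def split: nat.split)
    finally show ?thesis .
  qed
  have Tlaw: "pgf (law \<Omega> (T m)) z = pgf ?\<alpha> (?\<phi> m z)" if z: "0 < z" "z < 1" for m z
  proof (cases m)
    case 0
    have "law \<Omega> (T 0) = ?\<alpha>"
      using law\<Lambda>[of OutA] by (simp add: T_def[abs_def] \<Lambda>_def)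
    thus ?thesis using 0 by simp
  next
    case (Suc j)
    have "law \<Omega> (\<lambda>\<omega>. \<Sum>i=1..\<omega> (OutAs (Suc j + 1)). \<omega> (OutD (Suc j) i))
        = random_sum_law (law \<Omega> (\<lambda>\<omega>. \<omega> (OutAs (Suc j + 1)))) (D_law (Suc j))"
      by (rule \<Omega>.law_random_sum[where Y = "\<lambda>k \<omega>. \<omega> k", OF ind[of "\<lambda>k. k"]])
        (auto simp: inj_on_def law\<Lambda> \<Lambda>_def)
    hence "law \<Omega> (T m) = random_sum_law ?\<alpha> (D_law (Suc j))"
      using Suc by (simp add: T_def[abs_def] law\<Lambda> \<Lambda>_def)
    thus ?thesis
      using Suc z D[of j] by (simp add: pgf_random_sum_law[OF \<alpha>.nat_prob_space_axioms])
  qed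
  have "(\<integral>\<omega>. z ^ (\<Sum>m<n. T m \<omega>) \<partial>\<Omega>) = (\<Prod>m<n. pgf ?\<alpha> (?\<phi> m z))" if z: "0 < z" "z < 1" for n z
    using \<Omega>.pgf_indep_sum[OF \<Omega>.indep_vars_subset[OF Tind], of "{..<n}" z] z by (simp add: Tlaw)
  hence limT: "(\<lambda>n. \<integral>\<omega>. z ^ (\<Sum>m<n. T m \<omega>) \<partial>\<Omega>) \<longlonglongrightarrow> pgf ?\<xi> z" if "0 < z" "z < 1" for z
    using lim[OF that] that by simp

  \<comment> \<open>Passage to the limit\<close>
  have fin: "AE \<omega> in \<Omega>. summable (\<lambda>m. T m \<omega>)" "?\<xi> = law \<Omega> (\<lambda>\<omega>. \<Sum>m. T m \<omega>)"
    using \<Omega>.sum_law_eqI_pgf_limit[OF T \<xi>.nat_prob_space_axioms limT] by blast+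
  \<comment> \<open>A summable sequence vanishes from some \<open>n\<close> on, so both series are
    finite sums and the head term splits off.\<close>
  have shift: "summable (\<lambda>m. T (Suc m) \<omega>) \<and> (\<Sum>m. T m \<omega>) = T 0 \<omega> + (\<Sum>m. T (Suc m) \<omega>)"
    if sm: "summable (\<lambda>m. T m \<omega>)" for \<omega>
  proof -
    obtain n where n: "\<forall>m\<ge>n. T m \<omega> = 0" using sm unfolding summable_nat_iff ..
    have "(\<Sum>m. T m \<omega>) = (\<Sum>m<Suc n. T m \<omega>)" "(\<Sum>m. T (Suc m) \<omega>) = (\<Sum>m<n. T (Suc m) \<omega>)"
      using n by (auto intro!: suminf_nat_eq)
    moreover have "summable (\<lambda>m. T (Suc m) \<omega>)"
      using n unfolding summable_nat_iff by (intro exI[of _ n]) auto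
    ultimately show ?thesis by (simp add: sum.lessThan_Suc_shift del: sum.lessThan_Suc)
  qed
  \<comment> \<open>Where the series is not summable, the default value of \<open>suminf\<close> can
    make the two expressions differ. By \<open>fin\<close> this happens only on a null set, which
    does not affect the law.\<close>
  have sumlaw: "?\<xi> = law \<Omega> (\<lambda>\<omega>. T 0 \<omega> + (\<Sum>m. T (Suc m) \<omega>))"
  proof -
    have "(\<lambda>\<omega>. T 0 \<omega> + (\<Sum>m. T (Suc m) \<omega>)) \<in> measurable \<Omega> ?c"
      by (rule measurable_compose_countable[where g = "T 0", OF _ T])
        (rule measurable_compose[OF measurable_suminf_nat(1)[OF T]], simp)
    hence "law \<Omega> (\<lambda>\<omega>. \<Sum>m. T m \<omega>) = law \<Omega> (\<lambda>\<omega>. T 0 \<omega> + (\<Sum>m. T (Suc m) \<omega>))"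
      using fin(1) shift
      by (intro distr_cong_AE measurable_suminf_nat T refl) auto
    thus ?thesis using fin(2) by simp
  qed
  let ?I = "{OutA} \<union> {OutAs (n + 1) |n. n \<ge> 1} \<union> {OutD n i |n i. n \<ge> 1 \<and> i \<ge> 1}"
  have case_id: "(\<lambda>k. case k of OutA \<Rightarrow> (\<lambda>\<omega>. \<omega> OutA) | OutAs n \<Rightarrow> (\<lambda>\<omega>. \<omega> (OutAs n))
      | OutD n i \<Rightarrow> (\<lambda>\<omega>. \<omega> (OutD n i))) = (\<lambda>k (\<omega> :: output_index \<Rightarrow> nat). \<omega> k)"
    by (auto simp: fun_eq_iff split: output_index.split)
  \<comment> \<open>Every witness is a coordinate map: the laws come from
    \<open>law\<Lambda>\<close>, the independence from \<open>ind\<close>, and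
    \<open>case_id\<close> identifies the joint family with all coordinate maps.\<close>
  show ?thesis
  proof (rule exI[of _ \<Omega>], rule exI[of _ "\<lambda>\<omega>. \<omega> OutA"], rule exI[of _ "\<lambda>n \<omega>. \<omega> (OutAs n)"],
      rule exI[of _ "\<lambda>n i \<omega>. \<omega> (OutD n i)"], intro conjI)
    show "\<Omega>.indep_vars (\<lambda>_. ?c) (\<lambda>n \<omega>. \<omega> (OutAs n)) {1..}"
      by (rule ind) (auto simp: inj_on_def)
    show "\<Omega>.indep_vars (\<lambda>_. ?c) (\<lambda>k. case k of OutA \<Rightarrow> (\<lambda>\<omega>. \<omega> OutA) | OutAs n \<Rightarrow> (\<lambda>\<omega>. \<omega> (OutAs n))
      | OutD n i \<Rightarrow> (\<lambda>\<omega>. \<omega> (OutD n i))) ?I"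
      unfolding case_id by (rule ind) auto
    show "AE \<omega> in \<Omega>. summable (\<lambda>m. \<Sum>i=1..\<omega> (OutAs (Suc m + 1)). \<omega> (OutD (Suc m) i))"
    proof -
      have "AE \<omega> in \<Omega>. summable (\<lambda>m. T (Suc m) \<omega>)"
        using fin(1) by eventually_elim (use shift in blast)
      thus ?thesis by (simp add: T_def)
    qed
    show "?\<xi> = law \<Omega> (\<lambda>\<omega>. \<omega> OutA + (\<Sum>m. \<Sum>i=1..\<omega> (OutAs (Suc m + 1)). \<omega> (OutD (Suc m) i)))"
      using sumlaw by (simp add: T_def)
  qed (use \<Omega>.prob_space_axioms in \<open>auto simp: law\<Lambda> \<Lambda>_def\<close>)
qed

end
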